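(* Let $\mathcal{H}$ be a real Hilbert space, and let $A \in \mathcal{B}(\mathcal{H})$ be a positive self-adjoint operator. Suppose that $\|A\|$ is a simple eigenvalue of $A$, and let $u_0 \in \ker(\|A\| I - A)$ be a unit vector. Then, for any unit vector $u_1 \in \mathcal{H}$ such that $\|u_1 - u_0\| < 1/\sqrt{2}$, the operator $A$ is ergodic with respect to the cone $\mathcal{P}(u_1)$.
   Context: $\mathcal{B}(\mathcal{H})$ is the set of bounded linear operators on $\mathcal{H}$, and $I$ is the identity. Positive means $\langle u, Au\rangle \ge 0$ for all $u\in\mathcal{H}$. A simple eigenvalue is one whose eigenspace is one-dimensional. For a unit vector $w \in \mathcal{H}$, the cone with $w$ as its axis is $\mathcal{P}(w) := \{ u \in \mathcal{H} \mid \langle w, u\rangle \ge \|u\|/\sqrt{2}\}$; it is a Hilbert cone. Here a Hilbert cone in $\mathcal{H}$ is a non-empty subset $\mathcal{C}\subset\mathcal{H}$ such that: (i) $\mathcal{C}+\mathcal{C}\subset\mathcal{C}$, $[0,\infty)\cdot\mathcal{C}\subset\mathcal{C}$ and $\mathcal{C}\cap(-\mathcal{C})=\{0\}$; (ii) $\mathcal{C}$ is closed; (iii) $\langle u,v\rangle\ge 0$ for all $u,v\in\mathcal{C}$; (iv) for every $w\in\mathcal{H}$ there exist $u,v\in\mathcal{C}$ with $w=u-v$ and $\langle u,v\rangle=0$. An operator $A\in\mathcal{B}(\mathcal{H})$ is ergodic with respect to a Hilbert cone $\mathcal{C}$ if the sequence $\{A^n\}_{n\in\mathbb{N}}$ is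 ergodic with respect to $\mathcal{C}$, i.e. for any $u,v\in\mathcal{C}\setminus\{0\}$ there exists $n\in\mathbb{N}$ such that $\langle u, A^n v\rangle>0$. *)

theory Defs
  imports "HOL-Analysis.Analysis"
begin

text \<open>
  A real Hilbert space is a type of sort \<open>{real_inner, complete_space}\<close>. Bounded operators on it
  are elements of the type of bounded linear functions, whose norm is the operator norm.
\<close>

definition selfadjoint_op :: "('a::real_inner \<Rightarrow>\<^sub>L 'a) \<Rightarrow> bool" where
  "selfadjoint_op A \<longleftrightarrow> (\<forall>u v. A u \<bullet> v = u \<bullet> A v)"

definition positive_op :: "('a::real_inner \<Rightarrow>\<^sub>L 'a) \<Rightarrow> bool" where
  "positive_op A \<longleftrightarrow> (\<forall>u. 0 \<le> u \<bullet> A u)"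

definition kernel_op :: "('a::real_normed_vector \<Rightarrow>\<^sub>L 'a) \<Rightarrow> 'a set" where
  "kernel_op A = {u. A u = 0}"

text \<open>Since \<open>dim\<close> is 0 for infinite-dimensional subspaces, \<open>dim S = 1\<close> does say that the
  subspace \<open>S\<close> is one-dimensional; in particular the eigenspace below is then nonzero.\<close>

definition simple_eigenvalue :: "('a::real_normed_vector \<Rightarrow>\<^sub>L 'a) \<Rightarrow> real \<Rightarrow> bool" where
  "simple_eigenvalue A \<mu> \<longleftrightarrow> dim (kernel_op (\<mu> *\<^sub>R id_blinfun - A)) = 1"

definition hilbert_cone :: "'a::real_inner set \<Rightarrow> bool" where
  "hilbert_cone C \<longleftrightarrow>
     C \<noteq> {} \<and>
     (\<forall>u\<in>C. \<forall>v\<in>C. u + v \<in> C) \<and>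
     (\<forall>t\<ge>0. \<forall>u\<in>C. t *\<^sub>R u \<in> C) \<and>
     C \<inter> uminus ` C = {0} \<and>
     closed C \<and>
     (\<forall>u\<in>C. \<forall>v\<in>C. 0 \<le> u \<bullet> v) \<and>
     (\<forall>w. \<exists>u\<in>C. \<exists>v\<in>C. w = u - v \<and> u \<bullet> v = 0)"

definition axis_cone :: "'a::real_inner \<Rightarrow> 'a set" where
  "axis_cone w = {u. w \<bullet> u \<ge> norm u / sqrt 2}"

definition op_power :: "('a::real_normed_vector \<Rightarrow>\<^sub>L 'a) \<Rightarrow> nat \<Rightarrow> ('a \<Rightarrow>\<^sub>L 'a)" where
  "op_power A n = ((\<lambda>B. A o\<^sub>L B) ^^ n) id_blinfun"

text \<open>Ergodicity is only meant for Hilbert cones \<open>C\<close>. The index set includes \<open>n = 0\<close>: on a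
  one-dimensional space the zero operator has the simple eigenvalue \<open>0 = norm 0\<close> and is
  ergodic only by virtue of its zeroth power, the identity.\<close>

definition ergodic_seq :: "(nat \<Rightarrow> 'a::real_inner \<Rightarrow>\<^sub>L 'a) \<Rightarrow> 'a set \<Rightarrow> bool" where
  "ergodic_seq T C \<longleftrightarrow> (\<forall>u\<in>C - {0}. \<forall>v\<in>C - {0}. \<exists>n. u \<bullet> T n v > 0)"

definition ergodic_op :: "('a::real_inner \<Rightarrow>\<^sub>L 'a) \<Rightarrow> 'a set \<Rightarrow> bool" where
  "ergodic_op A C \<longleftrightarrow> ergodic_seq (op_power A) C"

lemma axis_cone_norm_sq:
  assumes "u \<in> axis_cone w"
  shows "0 \<le> w \<bullet> u" "(norm u)\<^sup>2 \<le> 2 * (w \<bullet> u)\<^sup>2"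
proof -
  have a: "norm u / sqrt 2 \<le> w \<bullet> u" using assms by (simp add: axis_cone_def)
  have b: "0 \<le> norm u / sqrt 2" by simp
  show "0 \<le> w \<bullet> u" using a b by linarith
  have "(norm u / sqrt 2)\<^sup>2 \<le> (w \<bullet> u)\<^sup>2" using a b by (rule power_mono)
  then show "(norm u)\<^sup>2 \<le> 2 * (w \<bullet> u)\<^sup>2" by (simp add: power_divide)
qed

lemma axis_coneI:
  assumes "0 \<le> w \<bullet> u" "(norm u)\<^sup>2 \<le> 2 * (w \<bullet> u)\<^sup>2"
  shows "u \<in> axis_cone w"
proof -
  have "(norm u / sqrt 2)\<^sup>2 \<le> (w \<bullet> u)\<^sup>2" using assms(2) by (simp add: power_divide)
  then have "norm u / sqrt 2 \<le> w \<bullet> u" using assms(1) by (rule power2_le_imp_le)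
  then show ?thesis by (simp add: axis_cone_def)
qed

lemma axis_cone_inner_nonneg:
  assumes w: "norm w = 1" and u: "u \<in> axis_cone w" and v: "v \<in> axis_cone w"
  shows "0 \<le> u \<bullet> v"
proof -
  define a where "a = w \<bullet> u"
  define b where "b = w \<bullet> v"
  define u' where "u' = u - a *\<^sub>R w"
  define v' where "v' = v - b *\<^sub>R w"
  have ww: "w \<bullet> w = 1" using w by (simp add: dot_square_norm)
  have ab: "0 \<le> a" "0 \<le> b" using u v axis_cone_norm_sq(1) by (auto simp: a_def b_def)
  have "(norm u')\<^sup>2 = (norm u)\<^sup>2 - a\<^sup>2"
    unfolding power2_norm_eq_inner u'_def
    by (simp add: inner_diff_left inner_diff_right ww a_def inner_commute power2_eq_square)
  then have "(norm u')\<^sup>2 \<le> a\<^sup>2" using axis_cone_norm_sq(2)[OF u] by (simp add: a_def)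
  then have nu: "norm u' \<le> a" using ab(1) by (rule power2_le_imp_le)
  have "(norm v')\<^sup>2 = (norm v)\<^sup>2 - b\<^sup>2"
    unfolding power2_norm_eq_inner v'_def
    by (simp add: inner_diff_left inner_diff_right ww b_def inner_commute power2_eq_square)
  then have "(norm v')\<^sup>2 \<le> b\<^sup>2" using axis_cone_norm_sq(2)[OF v] by (simp add: b_def)
  then have nv: "norm v' \<le> b" using ab(2) by (rule power2_le_imp_le)
  have "u \<bullet> v = a * b + u' \<bullet> v'"
    by (simp add: u'_def v'_def inner_diff_left inner_diff_right ww a_def b_def inner_commute)
  moreover have "\<bar>u' \<bullet> v'\<bar> \<le> norm u' * norm v'" by (rule Cauchy_Schwarz_ineq2)
  moreover have "norm u' * norm v' \<le> a * b" using nu nv ab by (intro mult_mono) auto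
  ultimately show ?thesis by linarith
qed

lemma axis_cone_scaleR: "0 \<le> t \<Longrightarrow> u \<in> axis_cone w \<Longrightarrow> t *\<^sub>R u \<in> axis_cone w"
  using mult_left_mono[of "norm u / sqrt 2" "w \<bullet> u" t] by (simp add: axis_cone_def)

lemma axis_cone_decomp:
  assumes w: "norm w = 1"
  shows "\<exists>u\<in>axis_cone w. \<exists>v\<in>axis_cone w. x = u - v \<and> u \<bullet> v = 0"
proof -
  define a where "a = w \<bullet> x"
  define y where "y = x - a *\<^sub>R w"
  define r where "r = norm y"
  have ww: "w \<bullet> w = 1" using w by (simp add: dot_square_norm)
  have wy: "w \<bullet> y = 0" by (simp add: y_def inner_diff_right ww a_def)
  have r2: "r\<^sup>2 = (norm x)\<^sup>2 - a\<^sup>2"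
    unfolding r_def power2_norm_eq_inner y_def
    by (simp add: inner_diff_left inner_diff_right ww a_def inner_commute power2_eq_square)
  have z: "0 \<in> axis_cone w" by (simp add: axis_cone_def)
  show ?thesis
  proof (cases "r \<le> \<bar>a\<bar>")
    case True
    then have "r\<^sup>2 \<le> a\<^sup>2" using power_mono[of r "\<bar>a\<bar>" 2] by (simp add: r_def)
    then have n: "(norm x)\<^sup>2 \<le> 2 * (w \<bullet> x)\<^sup>2" using r2 by (simp add: a_def)
    show ?thesis
    proof (cases "0 \<le> a")
      case True
      then have "x \<in> axis_cone w" using n by (intro axis_coneI) (simp_all add: a_def)
      then show ?thesis using z by (intro bexI[of _ x] bexI[of _ 0]) auto
    next
      case False
      then have "- x \<in> axis_cone w" using n by (intro axis_coneI) (simp_all add: a_def)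
      then show ?thesis using z by (intro bexI[of _ 0] bexI[of _ "- x"]) auto
    qed
  next
    case False
    then have r: "0 < r" by linarith
    define f where "f = (1 / r) *\<^sub>R y"
    have ff: "f \<bullet> f = 1" using r
      by (simp add: f_def r_def dot_square_norm power2_eq_square)
    have wf: "w \<bullet> f = 0" "f \<bullet> w = 0" using wy by (simp_all add: f_def inner_commute)
    have y: "y = r *\<^sub>R f" using r by (simp add: f_def)
    have p: "w + f \<in> axis_cone w" "w - f \<in> axis_cone w"
      by (rule axis_coneI;
          simp add: power2_norm_eq_inner inner_add_left inner_add_right
            inner_diff_left inner_diff_right ww ff wf)+
    let ?u = "((r + a) / 2) *\<^sub>R (w + f)" and ?v = "((r - a) / 2) *\<^sub>R (w - f)"
    have "?u \<in> axis_cone w" "?v \<in> axis_cone w"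
      using p False by (auto intro!: axis_cone_scaleR)
    moreover have "?u \<bullet> ?v = 0"
      by (simp add: inner_add_left inner_diff_right ww ff wf)
    moreover have "x = ?u - ?v"
    proof -
      have "?u - ?v = ((r + a) / 2 - (r - a) / 2) *\<^sub>R w + ((r + a) / 2 + (r - a) / 2) *\<^sub>R f"
        by (simp only: scaleR_add_left scaleR_diff_left scaleR_add_right scaleR_diff_right)
          simp
      also have "\<dots> = a *\<^sub>R w + r *\<^sub>R f" by (simp add: field_simps)
      also have "\<dots> = x" by (simp only: y[symmetric]) (simp add: y_def)
      finally show ?thesis by (rule sym)
    qed
    ultimately show ?thesis by blast
  qed
qed

theorem hilbert_cone_axis_cone:
  assumes w: "norm w = 1"
  shows "hilbert_cone (axis_cone w)"
proof -
  have "u + v \<in> axis_cone w" if "u \<in> axis_cone w" "v \<in> axis_cone w" for u v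
  proof -
    have "norm (u + v) / sqrt 2 \<le> norm u / sqrt 2 + norm v / sqrt 2"
      by (simp add: norm_triangle_ineq divide_right_mono flip: add_divide_distrib)
    with that show ?thesis by (simp add: axis_cone_def inner_add_right)
  qed
  moreover have z: "0 \<in> axis_cone w" by (simp add: axis_cone_def)
  moreover have "axis_cone w \<inter> uminus ` axis_cone w = {0}"
  proof -
    have "u = 0" if "u \<in> axis_cone w" "- u \<in> axis_cone w" for u
    proof -
      have "norm u / sqrt 2 \<le> 0" using that by (simp add: axis_cone_def)
      then show ?thesis by (simp add: divide_le_0_iff)
    qed
    then show ?thesis using z by force
  qed
  moreover have "closed (axis_cone w)"
    unfolding axis_cone_def by (intro closed_Collect_le continuous_intros) auto
  ultimately show ?thesis
    unfolding hilbert_cone_def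
    by (intro conjI ballI allI impI axis_cone_scaleR axis_cone_inner_nonneg[OF w]
        axis_cone_decomp[OF w]) auto
qed

end

theory Submission
  imports Defs
begin

text \<open>
  Write \<open>m = norm A\<close>, let \<open>T = A / m\<close> and let \<open>u\<close>, \<open>v\<close> be nonzero vectors of the cone with
  axis \<open>u1\<close>. The bound on \<open>norm (u1 - u0)\<close> makes \<open>u0\<close> have strictly positive inner product with
  \<open>u\<close> and \<open>v\<close> (\<open>axis_cone_inner_pos\<close>): passing from \<open>u1\<close> to \<open>u0\<close> lowers \<open>u1 \<bullet> u\<close>, which is at
  least \<open>norm u / sqrt 2\<close>, by strictly less than \<open>norm u / sqrt 2\<close>.

  The even powers of \<open>T\<close> converge strongly to the orthogonal projection onto the line spanned
  by \<open>u0\<close>, so \<open>u \<bullet> (T ^^ (2 * n)) v\<close> tends to \<open>(u0 \<bullet> u) * (u0 \<bullet> v) > 0\<close> and is therefore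
  positive for some \<open>n\<close>. This convergence can be had without the spectral theorem: \<open>T\<close> is a
  self-adjoint contraction, so the squared norms of the iterates decrease to a limit, and
  self-adjointness expresses the distance between two even iterates through these squared
  norms alone; the even iterates are thus Cauchy
  (\<open>selfadjoint_contraction_even_powers_converge\<close>). Their limit is fixed by the square of \<open>T\<close>,
  hence by \<open>T\<close> itself because \<open>T\<close> is positive (\<open>positive_op_fixed_of_square_fixed\<close>), and
  simplicity of the eigenvalue puts it on the line through \<open>u0\<close>.

  If \<open>m = 0\<close>, simplicity makes the whole space the line through \<open>u0\<close>, and the zeroth power
  already has the required property.
\<close>

lemma dim_eq_1_imp_multiple:
  fixes u x :: "'a::real_vector"
  assumes "dim S = 1" "u \<in> S" "u \<noteq> 0" "x \<in> S"
  obtains c where "x = c *\<^sub>R u"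
proof -
  obtain B where B: "S \<subseteq> span B" "card B = dim S"
    using basis_exists[of S] by metis
  then obtain b where "B = {b}" using assms(1) by (auto simp: card_1_singleton_iff)
  with B(1) have "S \<subseteq> range (\<lambda>c. c *\<^sub>R b)" by (simp add: span_singleton)
  then obtain c d where c: "u = c *\<^sub>R b" and d: "x = d *\<^sub>R b"
    using assms(2,4) by blast
  with assms(3) have "x = (d / c) *\<^sub>R u" by simp
  then show ?thesis by (rule that)
qed

lemma blinfun_apply_op_power: "blinfun_apply (op_power A n) v = (blinfun_apply A ^^ n) v"
  unfolding op_power_def by (induction n) auto

lemma funpow_scaleR_blinfun:
  fixes T :: "'a::real_normed_vector \<Rightarrow>\<^sub>L 'a"
  shows "(blinfun_apply (c *\<^sub>R T) ^^ n) v = c ^ n *\<^sub>R (blinfun_apply T ^^ n) v"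
proof (induction n)
  case (Suc n)
  have "(blinfun_apply (c *\<^sub>R T) ^^ Suc n) v =
      blinfun_apply (c *\<^sub>R T) (c ^ n *\<^sub>R (blinfun_apply T ^^ n) v)"
    by (simp only: funpow.simps o_apply Suc)
  also have "\<dots> = c ^ Suc n *\<^sub>R (blinfun_apply T ^^ Suc n) v"
    by (simp add: blinfun.scaleR_left blinfun.scaleR_right)
  finally show ?case .
qed simp

lemma selfadjoint_op_funpow:
  assumes "selfadjoint_op T"
  shows "(blinfun_apply T ^^ n) x \<bullet> y = x \<bullet> (blinfun_apply T ^^ n) y"
proof (induction n arbitrary: y)
  case (Suc n)
  have "(blinfun_apply T ^^ Suc n) x \<bullet> y = (blinfun_apply T ^^ n) x \<bullet> T y"
    using assms by (simp add: selfadjoint_op_def)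
  also have "\<dots> = x \<bullet> (blinfun_apply T ^^ Suc n) y"
    by (simp only: Suc funpow_Suc_right o_apply)
  finally show ?case .
qed simp

text \<open>
  With \<open>g n\<close> the squared norm of the \<open>n\<close>-th iterate, self-adjointness turns the inner product
  of iterates \<open>2 * i\<close> and \<open>2 * j\<close> into \<open>g (i + j)\<close>, so their squared distance is
  \<open>g (2 * i) - 2 * g (i + j) + g (2 * j)\<close>. Since \<open>g\<close> is decreasing and bounded below, this
  becomes small. The argument needs exponents of equal parity, and the full sequence of
  iterates need not converge, as \<open>T = - I\<close> shows.
\<close>
lemma selfadjoint_contraction_even_powers_converge:
  fixes T :: "'a::{real_inner, complete_space} \<Rightarrow>\<^sub>L 'a"
  assumes sa: "selfadjoint_op T" and le: "norm T \<le> 1"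
  obtains p where "(\<lambda>n. (blinfun_apply T ^^ (2 * n)) v) \<longlonglongrightarrow> p" "T (T p) = p"
proof -
  define X where "X n = (blinfun_apply T ^^ n) v" for n
  define g where "g n = (norm (X n))\<^sup>2" for n
  have contr: "norm (T x) \<le> norm x" for x
    using norm_blinfun[of T x] mult_right_mono[OF le, of "norm x"] by simp
  have X_Suc: "X (Suc n) = T (X n)" for n by (simp add: X_def)
  have "decseq g"
    unfolding g_def by (intro decseq_SucI power_mono) (simp_all add: X_Suc contr)
  moreover have "bdd_below (range g)" by (rule bdd_belowI[of _ 0]) (auto simp: g_def)
  ultimately obtain L where L: "g \<longlonglongrightarrow> L" and Lle: "\<And>n. L \<le> g n"
    by (metis LIMSEQ_decseq_INF decseq_ge)
  have inner_even: "X (2 * i) \<bullet> X (2 * j) = g (i + j)" for i j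
  proof -
    have "X (2 * i) \<bullet> X (2 * j) = v \<bullet> (blinfun_apply T ^^ (2 * i + 2 * j)) v"
      by (simp add: X_def selfadjoint_op_funpow[OF sa] funpow_add)
    also have "2 * i + 2 * j = (i + j) + (i + j)" by simp
    also have "v \<bullet> (blinfun_apply T ^^ \<dots>) v = g (i + j)"
      unfolding g_def X_def power2_norm_eq_inner selfadjoint_op_funpow[OF sa]
      by (simp only: funpow_add o_apply)
    finally show ?thesis .
  qed
  have dist_even: "(dist (X (2 * i)) (X (2 * j)))\<^sup>2 = g (2 * i) - 2 * g (i + j) + g (2 * j)" for i j
    unfolding dist_norm power2_norm_eq_inner
    by (simp add: inner_diff_left inner_diff_right inner_even add.commute[of j i] flip: mult_2)
  have "Cauchy (\<lambda>n. X (2 * n))"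
  proof (rule metric_CauchyI)
    fix e :: real assume e: "0 < e"
    then have "eventually (\<lambda>n. g n < L + e\<^sup>2 / 2) sequentially"
      using order_tendstoD(2)[OF L, of "L + e\<^sup>2 / 2"] by simp
    then obtain N where N: "\<And>n. n \<ge> N \<Longrightarrow> g n < L + e\<^sup>2 / 2"
      by (auto simp: eventually_sequentially)
    have "dist (X (2 * i)) (X (2 * j)) < e" if "i \<ge> N" "j \<ge> N" for i j
    proof -
      have "(dist (X (2 * i)) (X (2 * j)))\<^sup>2 < e\<^sup>2"
        unfolding dist_even using N[of "2 * i"] N[of "2 * j"] Lle[of "i + j"] that by simp
      then show ?thesis using e by (simp add: power2_less_imp_less)
    qed
    then show "\<exists>M. \<forall>i\<ge>M. \<forall>j\<ge>M. dist (X (2 * i)) (X (2 * j)) < e" by blast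
  qed
  then obtain p where p: "(\<lambda>n. X (2 * n)) \<longlonglongrightarrow> p"
    by (auto simp: Cauchy_convergent_iff convergent_def)
  have "(\<lambda>n. X (2 * Suc n)) \<longlonglongrightarrow> T (T p)"
    by (simp add: X_Suc) (intro tendsto_intros p)
  moreover have "(\<lambda>n. X (2 * Suc n)) \<longlonglongrightarrow> p"
    by (rule LIMSEQ_Suc[OF p])
  ultimately have "T (T p) = p" by (rule LIMSEQ_unique)
  with p show ?thesis unfolding X_def by (rule that)
qed

text \<open>If nonzero, \<open>p - T p\<close> would be an eigenvector for \<open>- 1\<close>, which positivity excludes.\<close>
lemma positive_op_fixed_of_square_fixed:
  assumes "positive_op T" "T (T p) = p"
  shows "T p = p"
proof -
  define q where "q = p - T p"
  have "T q = - q" by (simp add: q_def blinfun.diff_right assms(2))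
  then have "q \<bullet> q \<le> 0" using assms(1)[unfolded positive_op_def, rule_format, of q] by simp
  then have "q = 0" by (metis antisym inner_ge_zero inner_eq_zero_iff)
  then show ?thesis by (simp add: q_def)
qed

lemma axis_cone_inner_pos:
  assumes "norm (w - z) < 1 / sqrt 2" "u \<in> axis_cone w" "u \<noteq> 0"
  shows "0 < z \<bullet> u"
proof -
  have "(w - z) \<bullet> u \<le> norm (w - z) * norm u" by (rule norm_cauchy_schwarz)
  also have "\<dots> < norm u / sqrt 2"
    using mult_strict_right_mono[OF assms(1), of "norm u"] assms(3) by simp
  also have "\<dots> \<le> w \<bullet> u" using assms(2) by (simp add: axis_cone_def)
  finally show ?thesis by (simp add: inner_diff_left)
qed

theorem theorem3p6:
  fixes A :: "'a::{real_inner, complete_space} \<Rightarrow>\<^sub>L 'a"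
    and u0 u1 :: 'a
  assumes "selfadjoint_op A"
    and "positive_op A"
    and "simple_eigenvalue A (norm A)"
    and "u0 \<in> kernel_op (norm A *\<^sub>R id_blinfun - A)"
    and "norm u0 = 1"
    and "norm u1 = 1"
    and "norm (u1 - u0) < 1 / sqrt 2"
  shows "ergodic_op A (axis_cone u1)"
  unfolding ergodic_op_def ergodic_seq_def
proof (intro ballI)
  fix u v assume "u \<in> axis_cone u1 - {0}" "v \<in> axis_cone u1 - {0}"
  then have pos: "0 < u0 \<bullet> u" "0 < u0 \<bullet> v"
    using axis_cone_inner_pos[OF assms(7)] by auto
  define m where "m = norm A"
  have eigen_iff: "x \<in> kernel_op (m *\<^sub>R id_blinfun - A) \<longleftrightarrow> A x = m *\<^sub>R x" for x
    by (auto simp: kernel_op_def minus_blinfun.rep_eq scaleR_blinfun.rep_eq)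
  have eigen_u0: "A u0 = m *\<^sub>R u0" using assms(4) eigen_iff by (simp add: m_def)
  have u0u0: "u0 \<bullet> u0 = 1" using assms(5) by (simp add: dot_square_norm)
  have line: "x = (u0 \<bullet> x) *\<^sub>R u0" if eigen_x: "A x = m *\<^sub>R x" for x
  proof -
    have "dim (kernel_op (m *\<^sub>R id_blinfun - A)) = 1"
      using assms(3) by (simp add: simple_eigenvalue_def m_def)
    moreover have "u0 \<noteq> 0" using assms(5) by auto
    ultimately obtain c where "x = c *\<^sub>R u0"
      using eigen_iff[THEN iffD2, OF eigen_u0] eigen_iff[THEN iffD2, OF eigen_x]
      by (elim dim_eq_1_imp_multiple)
    then show ?thesis by (simp add: u0u0)
  qed
  show "\<exists>n. 0 < u \<bullet> op_power A n v"
  proof (cases "m = 0")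
    case True
    then have "A v = m *\<^sub>R v" by (simp add: m_def)
    from line[OF this] have "u \<bullet> v = (u0 \<bullet> v) * (u0 \<bullet> u)"
      by (metis inner_scaleR_right inner_commute)
    then have "0 < u \<bullet> op_power A 0 v" using pos by (simp add: op_power_def)
    then show ?thesis ..
  next
    case False
    then have m: "0 < m" by (simp add: m_def)
    define T where "T = (1 / m) *\<^sub>R A"
    have A_T: "A = m *\<^sub>R T" using m by (simp add: T_def)
    have T_apply: "T x = (1 / m) *\<^sub>R A x" for x by (simp add: T_def scaleR_blinfun.rep_eq)
    have sa: "selfadjoint_op T" using assms(1) by (simp add: selfadjoint_op_def T_apply)
    have T_pos: "positive_op T" using assms(2) m by (simp add: positive_op_def T_apply)
    have "norm T \<le> 1" using m by (simp add: T_def m_def)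
    then obtain p where p: "(\<lambda>n. (blinfun_apply T ^^ (2 * n)) v) \<longlonglongrightarrow> p" "T (T p) = p"
      using selfadjoint_contraction_even_powers_converge[OF sa] by metis
    have "T p = p" using T_pos p(2) by (rule positive_op_fixed_of_square_fixed)
    then have p_line: "p = (u0 \<bullet> p) *\<^sub>R u0"
      by (intro line) (simp add: A_T scaleR_blinfun.rep_eq)
    \<comment> \<open>The powers of \<open>T\<close> preserve the component along \<open>u0\<close>, so the limit has that of \<open>v\<close>.\<close>
    have "(blinfun_apply T ^^ n) u0 = u0" for n
      using m by (induction n) (simp_all add: T_apply eigen_u0)
    then have "u0 \<bullet> (blinfun_apply T ^^ n) v = u0 \<bullet> v" for n
      using selfadjoint_op_funpow[OF sa, of n u0 v] by simp
    then have "u0 \<bullet> p = u0 \<bullet> v"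
      using tendsto_inner[OF tendsto_const[of u0] p(1)] by (simp add: LIMSEQ_const_iff)
    then have "u \<bullet> p = (u0 \<bullet> v) * (u0 \<bullet> u)"
      using p_line by (metis inner_scaleR_right inner_commute)
    then have "0 < u \<bullet> p" using pos by simp
    with tendsto_inner[OF tendsto_const[of u] p(1)]
    have "eventually (\<lambda>n. 0 < u \<bullet> (blinfun_apply T ^^ (2 * n)) v) sequentially"
      by (rule order_tendstoD(1))
    then obtain n where "0 < u \<bullet> (blinfun_apply T ^^ (2 * n)) v"
      by (auto simp: eventually_sequentially)
    then have "0 < u \<bullet> op_power A (2 * n) v"
      using m
      by (simp only: blinfun_apply_op_power A_T funpow_scaleR_blinfun inner_scaleR_right)
        simp
    then show ?thesis ..
  qed
qed

end
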